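(* Let $h\in\mathbb{Z}$ with $3\nmid h$ be such that $p=h^2+3h+9$ is a prime number, let $s\in\mathbb{R}$, $s\neq0$, and let $\rho(h,s,x)=x^3+hsx^2-(h+3)s^2x+s^3$. Put $$\theta_1(h,s,x)=\frac{x}{s}+\frac{h-1}{3},\qquad \theta_2(h,s,x)=-\frac{x}{s}-\frac{h+1}{3},$$ $$\gamma_1(h,s,x)=-\frac13 s(h-1-3x),\qquad \gamma_2(h,s,x)=-\frac13 s(h+1+3x).$$ Then the zeros of $\rho(h,s,x)$ are $$\gamma_1(h,s,\eta_p^{(k)}),\ k=0,1,2,\quad\text{if } h\equiv1\pmod 3,$$ $$\gamma_2(h,s,\eta_p^{(k)}),\ k=0,1,2,\quad\text{if } h\equiv2\pmod 3,$$ where $\eta_p^{(0)},\eta_p^{(1)},\eta_p^{(2)}$ are the cubic Gaussian periods of $p$. Therefore $$\rho(h,s,x)=s^3\,G_1(h,\theta_1(h,s,x))\quad\text{if } h\equiv1\pmod3,$$ $$\rho(h,s,x)=-s^3\,G_2(h,\theta_2(h,s,x))\quad\text{if } h\equiv2\pmod3,$$ where $$G_1(h,x)=x^3+x^2-\frac{p-1}{3}x+\frac{2hp+1}{27},\qquad G_2(h,x)=x^3+x^2-\frac{p-1}{3}x-\frac{(6+2h)p-1}{27}.$$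
   Context: For a prime $p\equiv1\pmod3$, let $C_0$ be the subgroup of $\mathbb{Z}_p^*=(\mathbb{Z}/p\mathbb{Z})^*$ consisting of the cubes (of order $\frac{p-1}{3}$), and let $C_1,C_2$ be the other two cosets of $C_0$ in $\mathbb{Z}_p^*$ (in any order). The cubic Gaussian periods are $\eta_p^{(k)}=\sum_{j\in C_k}e^{2\pi i j/p}$, $k=0,1,2$. (If $3\nmid h$ then $h^2+3h+9\equiv1\pmod3$.) *)

theory Defs
  imports
    "HOL-Analysis.Analysis"
    "HOL-Computational_Algebra.Polynomial"
    "HOL-Number_Theory.Residues"
    "HOL-Algebra.Coset"
begin

abbreviation residue_units :: "int \<Rightarrow> int monoid" where
  "residue_units p \<equiv> units_of (residue_ring p)"

definition residue_cubes :: "int \<Rightarrow> int set" where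
  "residue_cubes p =
     (\<lambda>x. x [^]\<^bsub>residue_units p\<^esub> (3::nat)) ` carrier (residue_units p)"

text \<open>The first coset is the subgroup of cubes itself; \<open>C 1\<close> and \<open>C 2\<close> are the remaining
  two cosets in an arbitrary order. Residue classes modulo \<open>p\<close> are represented by
  the integers \<open>0, \<dots>, p - 1\<close>.\<close>

definition cubic_coset_enumeration :: "int \<Rightarrow> (nat \<Rightarrow> int set) \<Rightarrow> bool" where
  "cubic_coset_enumeration p C \<longleftrightarrow>
     C 0 = residue_cubes p \<and>
     bij_betw C {0, 1, 2} (rcosets\<^bsub>residue_units p\<^esub> (residue_cubes p))"

definition gauss_period :: "int \<Rightarrow> (nat \<Rightarrow> int set) \<Rightarrow> nat \<Rightarrow> complex" where
  "gauss_period p C k =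
     (\<Sum>j\<in>C k. exp (2 * of_real pi * \<i> * of_int j / of_int p))"

definition rho :: "int \<Rightarrow> real \<Rightarrow> complex poly" where
  "rho h s = [: of_real s ^ 3, - (of_int h + 3) * of_real s ^ 2, of_int h * of_real s, 1 :]"

definition \<theta>\<^sub>1 :: "int \<Rightarrow> real \<Rightarrow> complex \<Rightarrow> complex" where
  "\<theta>\<^sub>1 h s x = x / of_real s + (of_int h - 1) / 3"

definition \<theta>\<^sub>2 :: "int \<Rightarrow> real \<Rightarrow> complex \<Rightarrow> complex" where
  "\<theta>\<^sub>2 h s x = - (x / of_real s) - (of_int h + 1) / 3"

definition \<gamma>\<^sub>1 :: "int \<Rightarrow> real \<Rightarrow> complex \<Rightarrow> complex" where
  "\<gamma>\<^sub>1 h s x = - (1 / 3) * of_real s * (of_int h - 1 - 3 * x)"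

definition \<gamma>\<^sub>2 :: "int \<Rightarrow> real \<Rightarrow> complex \<Rightarrow> complex" where
  "\<gamma>\<^sub>2 h s x = - (1 / 3) * of_real s * (of_int h + 1 + 3 * x)"

definition G\<^sub>1 :: "int \<Rightarrow> complex poly" where
  "G\<^sub>1 h = (let p = of_int (h\<^sup>2 + 3 * h + 9) in
     [: (2 * of_int h * p + 1) / 27, - ((p - 1) / 3), 1, 1 :])"

definition G\<^sub>2 :: "int \<Rightarrow> complex poly" where
  "G\<^sub>2 h = (let p = of_int (h\<^sup>2 + 3 * h + 9) in
     [: - (((6 + 2 * of_int h) * p - 1) / 27), - ((p - 1) / 3), 1, 1 :])"

end

theory Submission
  imports Defs
begin

text \<open>Let \<open>\<eta>\<^sub>i\<close> be the periods, \<open>f = (p - 1) / 3\<close>, and let \<open>(i, j)\<close> count the \<open>t \<in> C\<^sub>i\<close> with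
  \<open>t + 1 \<in> C\<^sub>j\<close>. Then \<open>\<eta>\<^sub>i \<eta>\<^sub>j = [i = j] f + (\<Sum>k. (j - i, k) \<eta>\<^bsub>i+k\<^esub>)\<close>, and by the symmetries
  \<open>t \<mapsto> - 1 - t\<close> and \<open>t \<mapsto> 1 / t\<close> only \<open>A = (0, 0)\<close>, \<open>B = (0, 1)\<close>, \<open>C = (0, 2)\<close> and \<open>D = (1, 2)\<close> occur.
  Computing \<open>\<eta>\<^sub>0 \<eta>\<^sub>1 \<eta>\<^sub>2\<close> in different orders gives \<open>B\<^sup>2 + C\<^sup>2 + D A = B C + C D + D B\<close>, which with
  \<open>A + B + C = f - 1\<close> and \<open>B + C + D = f\<close> becomes \<open>4 p = L\<^sup>2 + 27 (B - C)\<^sup>2\<close> for \<open>L = 9 A - 3 f + 7\<close>, and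
  all elementary symmetric functions of the periods are expressed by \<open>p\<close> and \<open>L\<close>. Since a prime
  has essentially one such representation, \<open>4 p = (2 h + 3)\<^sup>2 + 27\<close> forces \<open>L = \<plusminus> (2 h + 3)\<close>, and
  \<open>L \<equiv> 1 (mod 3)\<close> fixes the sign.\<close>

section \<open>Complex \<open>p\<close>-th roots of unity and their sum\<close>

definition root_unity :: "int \<Rightarrow> int \<Rightarrow> complex" where
  "root_unity p j = exp (2 * of_real pi * \<i> * of_int j / of_int p)"

lemma root_unity_add: "root_unity p (i + j) = root_unity p i * root_unity p j"
  by (simp add: root_unity_def algebra_simps add_divide_distrib exp_add)

lemma root_unity_mod:
  assumes "p \<noteq> 0"
  shows "root_unity p (j mod p) = root_unity p j"
proof -
  have "root_unity p (p * (j div p)) = 1"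
    using assms exp_2pi_1_int[of "j div p"] by (simp add: root_unity_def algebra_simps)
  then show ?thesis
    using root_unity_add[of p "p * (j div p)" "j mod p"] by simp
qed

lemma sum_root_unity:
  assumes "p > 1"
  shows "(\<Sum>j\<in>{1..<p}. root_unity p j) = -1"
proof -
  define z where "z = root_unity p 1"
  have pow: "root_unity p (int n) = z ^ n" for n
    by (induction n) (simp_all add: root_unity_def z_def algebra_simps add_divide_distrib exp_add)
  have "z \<noteq> 1"
    using complex_root_unity_eq_1[of "nat p" 1] assms
    by (auto simp: z_def root_unity_def of_nat_nat)
  moreover have "z ^ nat p = 1"
    using pow[of "nat p"] assms by (simp add: root_unity_def)
  ultimately have "(\<Sum>n<nat p. z ^ n) = 0"
    using geometric_sum[of z "nat p"] by simp
  also have "(\<Sum>n<nat p. z ^ n) = (\<Sum>j\<in>{0..<p}. root_unity p j)"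
    by (rule sum.reindex_bij_witness[of _ nat int]) (use assms in \<open>auto simp: pow\<close>)
  also have "{0..<p} = insert 0 {1..<p}"
    using assms by auto
  finally show ?thesis
    by (simp add: root_unity_def algebra_simps eq_neg_iff_add_eq_0)
qed

lemma mod_mem_nonzero_residues:
  fixes p x :: int
  assumes "p > 1" "\<not> p dvd x"
  shows "x mod p \<in> {1..<p}"
proof -
  have "x mod p \<noteq> 0" "0 \<le> x mod p" "x mod p < p"
    using assms by (auto simp: dvd_eq_mod_eq_0)
  then show ?thesis
    unfolding atLeastLessThan_iff by linarith
qed

section \<open>Cubic classes, periods and cyclotomic numbers for an abstract index\<close>

lemma sum_UNIV_3: "sum g (UNIV :: 3 set) = g 0 + g 1 + g 2"
proof -
  have "k \<in> {0, 1, 2}" for k :: 3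
    using exhaust_3[of k] by auto
  then have "sum g (UNIV :: 3 set) = sum g {0, 1, 2}"
    by (intro arg_cong[where f = "sum g"]) blast
  also have "\<dots> = g 0 + g 1 + g 2"
    by (simp add: add.assoc)
  finally show ?thesis .
qed

text \<open>Here \<open>3\<close> is the type of integers modulo 3, so the index is a surjective homomorphism
  \<open>(\<int>/p\<int>)\<^sup>* \<rightarrow> \<int>/3\<int>\<close>.\<close>

locale cubic_residue_index =
  fixes p :: int and ind :: "int \<Rightarrow> 3"
  assumes prime: "prime p"
    and ind_mult: "\<lbrakk>\<not> p dvd x; \<not> p dvd y\<rbrakk> \<Longrightarrow> ind (x * y) = ind x + ind y"
    and ind_mod: "ind (x mod p) = ind x"
    and ind_surj: "\<exists>x. \<not> p dvd x \<and> ind x = k"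
begin

definition cls :: "3 \<Rightarrow> int set" where
  "cls k = {x \<in> {1..<p}. ind x = k}"

definition period :: "3 \<Rightarrow> complex" where
  "period k = (\<Sum>x\<in>cls k. root_unity p x)"

text \<open>The cyclotomic numbers of order 3.\<close>

definition cyc :: "3 \<Rightarrow> 3 \<Rightarrow> nat" where
  "cyc i j = card {t \<in> cls i. t + 1 \<in> cls j}"

lemma p_gt_1: "p > 1"
  using prime prime_gt_1_int by blast

lemma not_dvd: "x \<in> {1..<p} \<Longrightarrow> \<not> p dvd x"
  using zdvd_not_zless by auto

lemmas mod_range = mod_mem_nonzero_residues[OF p_gt_1]

lemma not_dvd_mult: "\<lbrakk>\<not> p dvd x; \<not> p dvd y\<rbrakk> \<Longrightarrow> \<not> p dvd x * y"
  using prime prime_dvd_mult_iff by blast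

lemma finite_cls [simp]: "finite (cls k)"
  by (rule finite_subset[of _ "{1..<p}"]) (auto simp: cls_def)

lemma ind_1: "ind 1 = 0"
  using ind_mult[of 1 1] p_gt_1 by simp

text \<open>The index of -1 doubles to \<open>ind 1 = 0\<close>, and doubling is injective modulo
  3.\<close>

lemma ind_minus_1: "ind (-1) = 0"
proof -
  have "ind (-1) + ind (-1) = 0"
    using ind_mult[of "-1" "-1"] p_gt_1 ind_1 by simp
  then show ?thesis
    using exhaust_3[of "ind (-1)"] by auto
qed

lemma ind_uminus: "\<not> p dvd x \<Longrightarrow> ind (- x) = ind x"
  using ind_mult[of "-1" x] p_gt_1 ind_minus_1 by simp

lemma ind_cong: "[x = y] (mod p) \<Longrightarrow> ind x = ind y"
  by (metis cong_def ind_mod)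

lemma inverse_exists:
  assumes "\<not> p dvd x"
  obtains y where "y \<in> {1..<p}" "[x * y = 1] (mod p)" "ind y = - ind x"
proof -
  have "coprime x p"
    using assms prime by (metis coprime_commute prime_imp_coprime)
  then obtain z where z: "[x * z = 1] (mod p)"
    using cong_solve_coprime_int by blast
  have "\<not> p dvd x * z"
    using z p_gt_1 by (metis cong_dvd_iff zdvd1_eq less_irrefl abs_of_pos zero_less_one order_less_trans)
  then have nz: "\<not> p dvd z" by auto
  have "ind x + ind z = 0"
    using ind_cong[OF z] ind_mult[OF assms nz] ind_1 by simp
  then have "ind (z mod p) = - ind x"
    using ind_mod by (simp add: add_eq_0_iff)
  moreover have "[x * (z mod p) = 1] (mod p)"
    using z by (simp add: cong_def mod_mult_right_eq)
  ultimately show thesis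
    using that mod_range[OF nz] by blast
qed

text \<open>Multiplication by the inverse \<open>v\<close> of \<open>u\<close> modulo
  \<open>p\<close> undoes the map and shifts the index back.\<close>

lemma bij_betw_cls:
  assumes u: "\<not> p dvd u"
  shows "bij_betw (\<lambda>x. x * u mod p) (cls k) (cls (k + ind u))"
proof -
  obtain v where v: "v \<in> {1..<p}" "[u * v = 1] (mod p)" "ind v = - ind u"
    using inverse_exists[OF u] .
  have vnd: "\<not> p dvd v" using v(1) not_dvd by blast
  have inv: "x * u mod p * v mod p = x" "x * v mod p * u mod p = x" if "x \<in> {1..<p}" for x
  proof -
    have "[x * (u * v) = x * 1] (mod p)"
      using v(2) by (rule cong_scalar_left)
    then show "x * u mod p * v mod p = x" "x * v mod p * u mod p = x"
      using that by (simp_all add: cong_def mod_mult_left_eq mult.assoc mult.commute[of v u])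
  qed
  show ?thesis
  proof (rule bij_betw_byWitness[of _ "\<lambda>x. x * v mod p"])
    show "(\<lambda>x. x * u mod p) ` cls k \<subseteq> cls (k + ind u)"
      using mod_range[OF not_dvd_mult[OF not_dvd u]] ind_mult[OF not_dvd u]
      by (auto simp: cls_def ind_mod)
    show "(\<lambda>x. x * v mod p) ` cls (k + ind u) \<subseteq> cls k"
      using mod_range[OF not_dvd_mult[OF not_dvd vnd]] ind_mult[OF not_dvd vnd] v(3)
      by (auto simp: cls_def ind_mod)
  qed (use inv in \<open>auto simp: cls_def\<close>)
qed

lemma card_cls: "card (cls k) = card (cls 0)"
proof -
  obtain u where "\<not> p dvd u" "ind u = k"
    using ind_surj by blast
  then show ?thesis
    using bij_betw_same_card[OF bij_betw_cls[of u 0]] by simp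
qed

text \<open>This is the Galois action: raising the roots of unity to the power \<open>u\<close>
  permutes the periods cyclically, by the index of \<open>u\<close>.\<close>

lemma period_scale:
  assumes "\<not> p dvd u"
  shows "(\<Sum>x\<in>cls k. root_unity p (x * u)) = period (k + ind u)"
proof -
  have "(\<Sum>x\<in>cls k. root_unity p (x * u mod p)) = period (k + ind u)"
    unfolding period_def by (rule sum.reindex_bij_betw[OF bij_betw_cls[OF assms]])
  then show ?thesis
    using p_gt_1 by (simp add: root_unity_mod)
qed

lemma range_eq_Union_cls: "{1..<p} = (\<Union>k\<in>UNIV. cls k)"
  by (auto simp: cls_def)

lemma sum_range_eq_sum_cls: "sum g {1..<p} = (\<Sum>k\<in>UNIV. sum g (cls k))"
  unfolding range_eq_Union_cls
  by (rule sum.UNION_disjoint) (simp_all, auto simp: cls_def)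

lemma sum_period: "period 0 + period 1 + period 2 = -1"
  using sum_root_unity[OF p_gt_1] sum_range_eq_sum_cls[of "root_unity p"]
  by (simp add: period_def sum_UNIV_3)

lemma p_eq: "p = 3 * int (card (cls 0)) + 1"
proof -
  have "nat (p - 1) = (\<Sum>k\<in>UNIV. card (cls k))"
    using sum_range_eq_sum_cls[of "\<lambda>_. 1 :: nat"] by simp
  also have "\<dots> = 3 * card (cls 0)"
    using card_cls[of 1] card_cls[of 2] by (simp add: sum_UNIV_3)
  finally show ?thesis using p_gt_1 by linarith
qed

text \<open>Sorting the \<open>t\<close> of a class by the class of \<open>t + 1\<close> produces
  cyclotomic numbers. The one \<open>t\<close> for which \<open>t + 1\<close> is in no class is
  \<open>p - 1\<close>; it gets the separate value \<open>c\<close> and lies in class 0 because -1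
  has index 0. The semiring is general so that the lemma serves both the products of periods and the
  counting of a class.\<close>

lemma sum_cls_succ:
  fixes g :: "3 \<Rightarrow> 'a :: comm_semiring_1"
  shows "(\<Sum>t\<in>cls d. if t = p - 1 then c else g (ind (t + 1))) =
         (if d = 0 then c else 0) + (\<Sum>k\<in>UNIV. of_nat (cyc d k) * g k)"
proof -
  have "(if t = p - 1 then c else g (ind (t + 1))) =
        (if t = p - 1 then c else 0) + (\<Sum>k\<in>UNIV. if t + 1 \<in> cls k then g k else 0)"
    if "t \<in> cls d" for t
  proof (cases "t = p - 1")
    case False
    then have "t + 1 \<in> cls k \<longleftrightarrow> ind (t + 1) = k" for k
      using that by (auto simp: cls_def)
    then show ?thesis
      using False by simp
  qed (simp add: cls_def)
  then have "(\<Sum>t\<in>cls d. if t = p - 1 then c else g (ind (t + 1))) =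
      (\<Sum>t\<in>cls d. if t = p - 1 then c else 0) +
      (\<Sum>k\<in>UNIV. \<Sum>t\<in>cls d. if t + 1 \<in> cls k then g k else 0)"
    by (subst sum.swap) (simp add: sum.distrib)
  also have "(\<Sum>t\<in>cls d. if t = p - 1 then c else 0) = (if d = 0 then c else 0)"
  proof -
    have "ind (p - 1) = 0"
      using ind_cong[of "p - 1" "-1"] ind_minus_1 by (simp add: cong_iff_dvd_diff)
    then have "p - 1 \<in> cls d \<longleftrightarrow> d = 0"
      using p_gt_1 by (auto simp: cls_def)
    then show ?thesis
      by simp
  qed
  also have "(\<Sum>k\<in>UNIV. \<Sum>t\<in>cls d. if t + 1 \<in> cls k then g k else 0) =
      (\<Sum>k\<in>UNIV. of_nat (cyc d k) * g k)"
    by (simp add: cyc_def flip: sum.inter_filter)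
  finally show ?thesis .
qed

text \<open>For fixed \<open>x\<close> in class \<open>i\<close>, the elements of class
  \<open>j\<close> are the residues of \<open>x * t\<close> with \<open>t\<close> in class
  \<open>j - i\<close>. After exchanging the sums, the inner sum over \<open>x\<close> is a period
  scaled by \<open>t + 1\<close>, except for \<open>t = p - 1\<close>, where every summand is
  1.\<close>

lemma period_mult:
  "period i * period j = (if i = j then of_nat (card (cls 0)) else 0) +
     (\<Sum>k\<in>UNIV. of_nat (cyc (j - i) k) * period (i + k))"
proof -
  have "period i * period j = (\<Sum>x\<in>cls i. \<Sum>t\<in>cls (j - i). root_unity p (x * (t + 1)))"
  proof -
    have "root_unity p x * period j = (\<Sum>t\<in>cls (j - i). root_unity p (x * (t + 1)))"
      if "x \<in> cls i" for x
    proof -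
      have "\<not> p dvd x" "ind x = i"
        using that not_dvd by (auto simp: cls_def)
      then have "period j = (\<Sum>t\<in>cls (j - i). root_unity p (t * x))"
        using period_scale[of x "j - i"] by simp
      then show ?thesis
        by (simp add: sum_distrib_left root_unity_add algebra_simps)
    qed
    then show ?thesis
      by (subst (1) period_def) (simp add: sum_distrib_right)
  qed
  also have "\<dots> = (\<Sum>t\<in>cls (j - i). \<Sum>x\<in>cls i. root_unity p (x * (t + 1)))"
    by (rule sum.swap)
  also have "\<dots> = (\<Sum>t\<in>cls (j - i). if t = p - 1 then of_nat (card (cls 0))
                                   else period (i + ind (t + 1)))"
  proof (rule sum.cong[OF refl])
    fix t assume t: "t \<in> cls (j - i)"
    show "(\<Sum>x\<in>cls i. root_unity p (x * (t + 1))) =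
          (if t = p - 1 then of_nat (card (cls 0)) else period (i + ind (t + 1)))"
    proof (cases "t = p - 1")
      case True
      have "root_unity p (x * p) = 1" for x
        using root_unity_mod[of p "x * p"] p_gt_1 by (simp add: root_unity_def)
      then show ?thesis
        using True card_cls[of i] by simp
    next
      case False
      then have "\<not> p dvd t + 1"
        using t by (intro not_dvd) (auto simp: cls_def)
      then show ?thesis
        using False period_scale by simp
    qed
  qed
  also have "\<dots> = (if j - i = 0 then of_nat (card (cls 0)) else 0) +
     (\<Sum>k\<in>UNIV. of_nat (cyc (j - i) k) * period (i + k))"
    by (rule sum_cls_succ)
  finally show ?thesis
    by (cases "i = j") simp_all
qed

lemma sum_cyc: "(\<Sum>k\<in>UNIV. cyc d k) + (if d = 0 then 1 else 0) = card (cls 0)"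
  using sum_cls_succ[where d = d and c = "1 :: nat" and g = "\<lambda>_. 1"] card_cls[of d] by simp

text \<open>Substitute \<open>t \<mapsto> - 1 - t\<close>, using that \<open>- 1\<close> is a cube.\<close>

lemma cyc_commute: "cyc i j = cyc j i"
  unfolding cyc_def
proof (rule bij_betw_same_card[OF bij_betw_byWitness[of _ "\<lambda>t. p - 1 - t"]])
  have "p - 1 - t \<in> cls j \<and> p - 1 - t + 1 \<in> cls i"
    if "t \<in> cls i" "t + 1 \<in> cls j" for i j t
  proof -
    have t: "t \<in> {1..<p}" "t + 1 \<in> {1..<p}" "ind t = i" "ind (t + 1) = j"
      using that by (auto simp: cls_def)
    have "ind (p - 1 - t) = ind (- (t + 1))" "ind (p - t) = ind (- t)"
      by (rule ind_cong, simp add: cong_iff_dvd_diff)+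
    then show ?thesis
      using t ind_uminus[OF not_dvd[OF t(1)]] ind_uminus[OF not_dvd[OF t(2)]]
      by (auto simp: cls_def)
  qed
  then show "(\<lambda>t. p - 1 - t) ` {t \<in> cls i. t + 1 \<in> cls j} \<subseteq> {t \<in> cls j. t + 1 \<in> cls i}"
    "(\<lambda>t. p - 1 - t) ` {t \<in> cls j. t + 1 \<in> cls i} \<subseteq> {t \<in> cls i. t + 1 \<in> cls j}"
    by blast+
qed auto

text \<open>Substitute \<open>t \<mapsto> 1 / t\<close>, so that \<open>t + 1 \<mapsto> (t + 1) / t\<close>.\<close>

lemma cyc_inverse: "cyc i j = cyc (- i) (j - i)"
proof -
  have "\<forall>t\<in>{1..<p}. \<exists>y. y \<in> {1..<p} \<and> [t * y = 1] (mod p) \<and> ind y = - ind t"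
    by (meson inverse_exists not_dvd)
  then obtain r where r: "\<And>t. t \<in> {1..<p} \<Longrightarrow>
      r t \<in> {1..<p} \<and> [t * r t = 1] (mod p) \<and> ind (r t) = - ind t"
    by metis
  \<comment> \<open>An inequality for all indices suffices, since the map from \<open>(i, j)\<close>
    to \<open>(- i, j - i)\<close> is an involution; an injection by \<open>r\<close> provides
    it.\<close>
  have "cyc i j \<le> cyc (- i) (j - i)" for i j
    unfolding cyc_def
  proof (rule card_inj_on_le)
    have cong_range: "x = y" if "[x = y] (mod p)" "x \<in> {1..<p}" "y \<in> {1..<p}" for x y
      using that by (simp add: cong_def)
    show "inj_on r {t \<in> cls i. t + 1 \<in> cls j}"
    proof (rule inj_onI)
      fix x y assume "x \<in> {t \<in> cls i. t + 1 \<in> cls j}" "y \<in> {t \<in> cls i. t + 1 \<in> cls j}"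
        and eq: "r x = r y"
      then have xy: "x \<in> {1..<p}" "y \<in> {1..<p}"
        by (auto simp: cls_def)
      have "[x * r x = y * r x] (mod p)"
        using r[OF xy(1)] r[OF xy(2)] eq by (metis cong_sym cong_trans)
      then have "p dvd (x - y) * r x"
        by (simp add: cong_iff_dvd_diff algebra_simps)
      then have "p dvd x - y"
        using r[OF xy(1)] not_dvd prime prime_dvd_mult_iff by blast
      then show "x = y"
        using xy by (intro cong_range) (simp_all add: cong_iff_dvd_diff)
    qed
    show "r ` {t \<in> cls i. t + 1 \<in> cls j} \<subseteq> {t \<in> cls (- i). t + 1 \<in> cls (j - i)}"
    proof (rule image_subsetI)
      fix t assume "t \<in> {t \<in> cls i. t + 1 \<in> cls j}"
      then have t: "t \<in> {1..<p}" "t + 1 \<in> {1..<p}" "ind t = i" "ind (t + 1) = j"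
        by (auto simp: cls_def)
      note rt = r[OF t(1)]
      have nd: "\<not> p dvd t + 1" "\<not> p dvd r t"
        using t(2) rt not_dvd by blast+
      have c: "[(t + 1) * r t = r t + 1] (mod p)"
        using rt cong_add_lcancel[of "r t" "t * r t" 1 p] by (simp add: algebra_simps)
      have "ind (r t + 1) = j - i"
        using ind_cong[OF c] ind_mult[OF nd] rt t by simp
      moreover have "r t + 1 \<in> {1..<p}"
      proof -
        \<comment> \<open>Since \<open>r t < p\<close>, the only way for \<open>r t + 1\<close> to
          leave the range is to equal \<open>p\<close>.\<close>
        have "\<not> p dvd r t + 1"
          using c not_dvd_mult[OF nd] cong_dvd_iff by blast
        then show ?thesis
          using rt by (cases "r t + 1 = p") auto
      qed
      ultimately show "r t \<in> {t \<in> cls (- i). t + 1 \<in> cls (j - i)}"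
        using rt t by (auto simp: cls_def)
    qed
  qed auto
  from this[of i j] this[of "- i" "j - i"] show ?thesis
    by simp
qed

section \<open>Relations between the cyclotomic numbers and the cubic satisfied by the
  periods\<close>

text \<open>Beyond \<open>p\<close>, the symmetric functions of the periods involve only
  \<open>L\<close>. The witness for \<open>M\<close> is \<open>B - C\<close>, whose sign depends on
  the order of classes 1 and 2.\<close>

lemma period_invariants:
  obtains L M :: int where
    "[L = 1] (mod 3)" "4 * p = L\<^sup>2 + 27 * M\<^sup>2"
    "period 0 * period 1 + period 1 * period 2 + period 2 * period 0 = - ((of_int p - 1) / 3)"
    "27 * (period 0 * period 1 * period 2) = of_int p * (of_int L + 3) - 1"
proof -
  define f where "f = int (card (cls 0))"
  define A where "A = int (cyc 0 0)"
  define B where "B = int (cyc 0 1)"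
  define C where "C = int (cyc 0 2)"
  define D where "D = int (cyc 1 2)"
  have mod_3: "- 1 = (2 :: 3)" "- 2 = (1 :: 3)" "3 = (0 :: 3)" "4 = (1 :: 3)"
    by simp_all
  \<comment> \<open>Rows 0 and 1 of the table of cyclotomic numbers are thus \<open>A, B, C\<close>
    and \<open>B, C, D\<close>. The six products below have \<open>j - i\<close> equal to 0 or 1
    modulo 3, so these rows suffice.\<close>
  have cyc: "cyc 1 0 = cyc 0 1" "cyc 1 1 = cyc 0 2"
    using cyc_inverse[of 1 1] by (simp_all add: mod_3 cyc_commute)
  have p: "p = 3 * f + 1"
    using p_eq by (simp add: f_def)
  have "int ((\<Sum>k\<in>UNIV. cyc 0 k) + 1) = f" "int (\<Sum>k\<in>UNIV. cyc 1 k) = f"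
    using sum_cyc[of 0] sum_cyc[of 1] unfolding f_def by simp_all
  then have A: "A = f - 1 - B - C" and D: "D = f - B - C"
    by (simp_all add: sum_UNIV_3 cyc A_def B_def C_def D_def)
  define x y z where "x = period 0" and "y = period 1" and "z = period 2"
  have sum: "x + y + z = -1"
    using sum_period by (simp add: x_def y_def z_def)
  have xy: "x * y = of_int B * x + of_int C * y + of_int D * z"
    and yz: "y * z = of_int B * y + of_int C * z + of_int D * x"
    and zx: "z * x = of_int B * z + of_int C * x + of_int D * y"
    and xx: "x * x = of_int f + of_int A * x + of_int B * y + of_int C * z"
    and yy: "y * y = of_int f + of_int A * y + of_int B * z + of_int C * x"
    and zz: "z * z = of_int f + of_int A * z + of_int B * x + of_int C * y"
    using period_mult[of 0 1] period_mult[of 1 2] period_mult[of 2 0]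
      period_mult[of 0 0] period_mult[of 1 1] period_mult[of 2 2]
    by (simp_all add: mod_3 sum_UNIV_3 cyc A_def B_def C_def D_def f_def x_def y_def z_def)
  have e2: "x * y + y * z + z * x = - of_int f"
  proof -
    have "x * y + y * z + z * x = of_int (B + C + D) * (x + y + z)"
      unfolding xy yz zx by (simp add: algebra_simps)
    then show ?thesis
      using sum D by simp
  qed
  define K where "K = B * C + C * D + D * B"
  define K' where "K' = B\<^sup>2 + C\<^sup>2 + D * A"
  \<comment> \<open>Expanding \<open>a * b\<close> first, and then its products with
    \<open>c\<close>, gives \<open>c\<close> the coefficient \<open>K'\<close> and both
    \<open>a\<close> and \<open>b\<close> the coefficient \<open>K\<close>. The hypotheses are kept
    by cyclic rotation, so the product can be expanded in three ways.\<close>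
  have e3: "a * b * c = of_int (D * f - K) + of_int (K' - K) * c"
    if "a + b + c = -1"
      and ab: "a * b = of_int B * a + of_int C * b + of_int D * c"
      and bc: "b * c = of_int B * b + of_int C * c + of_int D * a"
      and ca: "c * a = of_int B * c + of_int C * a + of_int D * b"
      and cc: "c * c = of_int f + of_int A * c + of_int B * a + of_int C * b"
    for a b c :: complex
  proof -
    have "a * b * c = of_int B * (c * a) + of_int C * (b * c) + of_int D * (c * c)"
      unfolding ab by (simp add: algebra_simps)
    also have "\<dots> = of_int (D * f) + of_int K' * c + of_int K * (a + b)"
      unfolding bc ca cc K_def K'_def by (simp add: algebra_simps power2_eq_square)
    also have "a + b = -1 - c"
      using that(1) by (simp add: algebra_simps add_eq_0_iff)
    finally show ?thesis
      by (simp add: algebra_simps)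
  qed
  have e3x: "y * z * x = of_int (D * f - K) + of_int (K' - K) * x"
    and e3y: "z * x * y = of_int (D * f - K) + of_int (K' - K) * y"
    and e3z: "x * y * z = of_int (D * f - K) + of_int (K' - K) * z"
    using e3[of y z x] e3[of z x y] e3[of x y z] xx yy zz xy yz zx sum by (simp_all add: add_ac)
  \<comment> \<open>Otherwise the expressions \<open>e3x\<close>, \<open>e3y\<close>, \<open>e3z\<close> for the same product force all periods to be equal.\<close>
  have K: "K' = K"
  proof (rule ccontr)
    assume "K' \<noteq> K"
    then have "of_int (K' - K) \<noteq> (0 :: complex)"
      by simp
    moreover have "y * z * x = x * y * z" "z * x * y = x * y * z"
      by (simp_all add: mult_ac)
    ultimately have "x = z" "y = z"
      using e3x e3y e3z by (metis add_left_imp_eq mult_cancel_left)+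
    \<comment> \<open>Equal periods would be \<open>-1/3\<close>, and \<open>e2\<close> would give
      \<open>1 = - 3 * f\<close>, impossible for an integer \<open>f\<close>.\<close>
    then have "3 * z = -1" "(3 * z) * (3 * z) = -3 * of_int f"
      using sum e2 by (simp_all add: mult_ac)
    then have "of_int (- (3 * f)) = (of_int 1 :: complex)"
      by simp
    then have "- (3 * f) = 1"
      by (simp only: of_int_eq_iff)
    then show False by presburger
  qed
  \<comment> \<open>As \<open>3 * f = p - 1\<close>, this is Gauss's formula
    \<open>9 * A = p - 8 + L\<close>.\<close>
  define L where "L = 9 * A - 3 * f + 7"
  show thesis
  proof
    show "[L = 1] (mod 3)"
      by (simp add: cong_iff_dvd_diff L_def)
    \<comment> \<open>After eliminating \<open>A\<close> and \<open>D\<close>, the right side minus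
      the left side is \<open>36 * (K' - K)\<close>.\<close>
    show "4 * p = L\<^sup>2 + 27 * (B - C)\<^sup>2"
      using K unfolding K_def K'_def L_def A D p by (simp add: algebra_simps power2_eq_square)
    show "period 0 * period 1 + period 1 * period 2 + period 2 * period 0 = - ((of_int p - 1) / 3)"
      using e2 p by (simp add: x_def y_def z_def)
    \<comment> \<open>Here the left side minus the right side is
      \<open>9 * (K' - K)\<close>.\<close>
    have "27 * (D * f - K) = p * (L + 3) - 1"
      using K unfolding K_def K'_def L_def A D p by (simp add: algebra_simps power2_eq_square)
    moreover have "x * y * z = of_int (D * f - K)"
      using e3z K by simp
    ultimately have "27 * (x * y * z) = of_int (p * (L + 3) - 1)"
      by (metis of_int_mult of_int_numeral)
    then show "27 * (period 0 * period 1 * period 2) = of_int p * (of_int L + 3) - 1"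
      by (simp add: x_def y_def z_def)
  qed
qed

end

section \<open>Uniqueness of the representation of \<open>4 * p\<close> by the norm form\<close>

text \<open>Combining both representations shows that \<open>p\<close> divides
  \<open>(L - u * M) * (L + u * M)\<close>, hence one factor. Brahmagupta's identity leaves that
  factor too little room to be nonzero, and then \<open>M\<close> squares to 1.\<close>

lemma norm_form_unique:
  fixes p L M u :: int
  assumes "prime p" and LM: "4 * p = L\<^sup>2 + 27 * M\<^sup>2" and u: "4 * p = u\<^sup>2 + 27"
  shows "L = u \<or> L = - u"
proof -
  have p: "p > 0"
    using assms(1) prime_gt_0_int by blast
  \<comment> \<open>The claim is stated for a fresh \<open>M\<close> so that it also applies to
    \<open>- M\<close>, which handles the other factor.\<close>
  have main: "L\<^sup>2 = u\<^sup>2" if dvd: "p dvd L - u * M" and LM: "4 * p = L\<^sup>2 + 27 * M\<^sup>2" for M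
  proof -
    have brahmagupta: "16 * p\<^sup>2 = (L * u + 27 * M)\<^sup>2 + 27 * (L - u * M)\<^sup>2"
    proof -
      have "16 * p\<^sup>2 = (4 * p) * (4 * p)"
        by (simp add: power2_eq_square)
      also have "\<dots> = (L\<^sup>2 + 27 * M\<^sup>2) * (u\<^sup>2 + 27)"
        by (subst LM, subst u) simp
      finally show ?thesis
        by (simp add: algebra_simps power2_eq_square)
    qed
    have "L - u * M = 0"
    \<comment> \<open>A nonzero multiple of \<open>p\<close> would contribute at least 27 times the
      square of \<open>p\<close>, but only 16 times that square is available.\<close>
    proof (rule ccontr)
      assume "L - u * M \<noteq> 0"
      then have "p \<le> \<bar>L - u * M\<bar>"
        using dvd p by (metis abs_of_pos dvd_imp_le_int)
      then have "p\<^sup>2 \<le> (L - u * M)\<^sup>2"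
        using p by (metis abs_le_square_iff abs_of_pos)
      moreover have "p\<^sup>2 > 0"
        using p by simp
      ultimately show False
        using brahmagupta zero_le_power2[of "L * u + 27 * M"] by linarith
    qed
    then have "L = u * M" by simp
    then have "4 * p = M\<^sup>2 * (4 * p)"
      using LM u by (simp add: algebra_simps)
    then have "M\<^sup>2 = 1"
      using p by simp
    then show ?thesis
      using \<open>L = u * M\<close> by (simp add: power_mult_distrib)
  qed
  have "(L - u * M) * (L + u * M) = L\<^sup>2 - u\<^sup>2 * M\<^sup>2"
    by (simp add: algebra_simps power2_eq_square)
  also have "\<dots> = (4 * p - 27 * M\<^sup>2) - (4 * p - 27) * M\<^sup>2"
    using LM u by simp
  also have "\<dots> = p * (4 * (1 - M\<^sup>2))"
    by (simp add: algebra_simps)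
  finally have "p dvd (L - u * M) * (L + u * M)"
    by simp
  then have "p dvd L - u * M \<or> p dvd L - u * (- M)"
    by (simp add: prime_dvd_mult_iff[OF assms(1)])
  then have "L\<^sup>2 = u\<^sup>2"
    using main[of M] main[of "- M"] LM by auto
  then show ?thesis
    by (simp add: power2_eq_iff)
qed

section \<open>From an enumeration of the cosets to an index homomorphism\<close>

text \<open>Either numbering of the two nontrivial cosets works, because exchanging 1 and 2 is the
  automorphism \<open>- k\<close> of the integers modulo 3. The addition table is recovered by
  exclusion: a factor of nonzero index changes the index of the other factor, and two factors of
  equal nonzero index have a product outside \<open>H\<close>.\<close>

lemma (in comm_group) index_3_hom:
  fixes C :: "nat \<Rightarrow> 'a set"
  assumes H: "subgroup H G" and cube: "\<And>x. x \<in> carrier G \<Longrightarrow> x \<otimes> (x \<otimes> x) \<in> H"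
    and C0: "C 0 = H" and bij: "bij_betw C {0, 1, 2} (rcosets H)"
  obtains ind :: "'a \<Rightarrow> 3" where
    "\<And>x y. \<lbrakk>x \<in> carrier G; y \<in> carrier G\<rbrakk> \<Longrightarrow> ind (x \<otimes> y) = ind x + ind y"
    "C 0 = {x \<in> carrier G. ind x = 0}"
    "C 1 = {x \<in> carrier G. ind x = 1}"
    "C 2 = {x \<in> carrier G. ind x = 2}"
proof -
  interpret H: subgroup H G by fact
  have cosets: "rcosets H = {C 0, C 1, C 2}"
    using bij by (auto simp: bij_betw_def)
  have distinct: "C 0 \<noteq> C 1" "C 0 \<noteq> C 2" "C 1 \<noteq> C 2"
    using bij by (auto simp: bij_betw_def inj_on_def)
  have disj: "C 0 \<inter> C 1 = {}" "C 0 \<inter> C 2 = {}" "C 1 \<inter> C 2 = {}"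
    using rcos_disjoint[OF H] cosets distinct by (auto simp: pairwise_def disjnt_def)
  have Un: "C 0 \<union> C 1 \<union> C 2 = carrier G"
    using rcosets_part_G[OF H] cosets by auto
  define ind :: "'a \<Rightarrow> 3" where
    "ind x = (if x \<in> C 1 then 1 else if x \<in> C 2 then 2 else 0)" for x
  have C: "C 0 = {x \<in> carrier G. ind x = 0}" "C 1 = {x \<in> carrier G. ind x = 1}"
    "C 2 = {x \<in> carrier G. ind x = 2}"
    using disj Un by (auto simp: ind_def)
  have H_iff: "x \<in> H \<longleftrightarrow> ind x = 0" if "x \<in> carrier G" for x
    using that unfolding C0[symmetric] C(1) by simp
  have ind_eq: "ind x = ind y \<longleftrightarrow> x \<otimes> inv y \<in> H" if x: "x \<in> carrier G" and y: "y \<in> carrier G" for x y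
  proof -
    have coset: "H #> z = {x \<in> carrier G. ind x = ind z}" if z: "z \<in> carrier G" for z
    proof -
      have "H #> z \<in> {C 0, C 1, C 2}" "z \<in> H #> z"
        using z rcosetsI[OF H.subset z] cosets rcos_self[OF z H] by auto
      then show ?thesis
        using C by auto
    qed
    have "ind x = ind y \<longleftrightarrow> x \<in> H #> y"
      using coset[OF y] x by auto
    also have "\<dots> \<longleftrightarrow> x \<otimes> inv y \<in> H"
      using H.rcos_module[OF is_group y x] .
    finally show ?thesis .
  qed
  have ind_mult_eq_right: "ind (x \<otimes> y) = ind y \<longleftrightarrow> ind x = 0"
    if "x \<in> carrier G" "y \<in> carrier G" for x y
    using that ind_eq[of "x \<otimes> y" y] H_iff by (simp add: m_assoc)
  have ind_mult_eq_left: "ind (x \<otimes> y) = ind x \<longleftrightarrow> ind y = 0"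
    if "x \<in> carrier G" "y \<in> carrier G" for x y
    using that ind_mult_eq_right[of y x] by (simp add: m_comm)
  \<comment> \<open>Otherwise the square of \<open>x\<close> would lie in \<open>H\<close>; with its
    cube in \<open>H\<close>, so would \<open>x\<close> itself.\<close>
  have ind_mult_nz: "ind (x \<otimes> y) \<noteq> 0" if xy: "x \<in> carrier G" "y \<in> carrier G" "ind x = ind y" "ind x \<noteq> 0" for x y
  proof
    assume "ind (x \<otimes> y) = 0"
    then have "x \<otimes> y \<in> H" "x \<otimes> inv y \<in> H"
      using xy H_iff ind_eq by auto
    then have "(x \<otimes> y) \<otimes> (x \<otimes> inv y) \<in> H"
      by (rule H.m_closed)
    also have "(x \<otimes> y) \<otimes> (x \<otimes> inv y) = x \<otimes> x"
      using xy by (simp add: m_ac)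
    finally have "ind (x \<otimes> x) = 0" using xy H_iff by simp
    moreover have "ind (x \<otimes> (x \<otimes> x)) = 0"
      using cube xy H_iff by simp
    ultimately show False
      using ind_mult_eq_right[of x "x \<otimes> x"] xy by simp
  qed
  have "ind (x \<otimes> y) = ind x + ind y" if xy: "x \<in> carrier G" "y \<in> carrier G" for x y
  proof -
    have "k = 0 \<or> k = 1 \<or> k = 2" for k :: 3
      using exhaust_3[of k] by auto
    from this[of "ind x"] this[of "ind y"] this[of "ind (x \<otimes> y)"] show ?thesis
      using ind_mult_eq_right[OF xy] ind_mult_eq_left[OF xy] ind_mult_nz[OF xy] by (elim disjE) simp_all
  qed
  then show thesis
    using that C by blast
qed

lemma cubic_residue_index_of_enumeration:
  assumes "prime p" and enum: "cubic_coset_enumeration p C"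
  obtains ind where "cubic_residue_index p ind"
    "C 0 = {x \<in> {1..<p}. ind x = 0}" "C 1 = {x \<in> {1..<p}. ind x = 1}"
    "C 2 = {x \<in> {1..<p}. ind x = 2}"
proof -
  have p: "p > 1"
    using assms(1) prime_gt_1_int by blast
  interpret R: residues p "residue_ring p"
    using p by unfold_locales simp_all
  interpret G: comm_group "residue_units p"
    by (rule R.units_comm_group)
  have "coprime x p" if "0 < x" "x < p" for x
    using that \<open>prime p\<close> zdvd_not_zless by (metis coprime_commute prime_imp_coprime)
  then have carrier: "carrier (residue_units p) = {1..<p}"
    by (auto simp: units_of_carrier R.res_units_eq)
  have mult: "x \<otimes>\<^bsub>residue_units p\<^esub> y = x * y mod p" for x y
    by (simp add: units_of_mult R.res_mult_eq)
  have subgroup: "subgroup (residue_cubes p) (residue_units p)"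
  proof -
    have "group_hom (residue_units p) (residue_units p) (\<lambda>x. x [^]\<^bsub>residue_units p\<^esub> (3::nat))"
      by unfold_locales (auto simp: hom_def G.nat_pow_distrib)
    then show ?thesis
      unfolding residue_cubes_def by (rule group_hom.img_is_subgroup)
  qed
  have cube: "x \<otimes>\<^bsub>residue_units p\<^esub> (x \<otimes>\<^bsub>residue_units p\<^esub> x) \<in> residue_cubes p"
    if "x \<in> carrier (residue_units p)" for x
    unfolding residue_cubes_def
    using that by (intro image_eqI[of _ _ x]) (simp_all add: numeral_3_eq_3 G.m_assoc)
  have C0: "C 0 = residue_cubes p"
    and bij: "bij_betw C {0, 1, 2} (rcosets\<^bsub>residue_units p\<^esub> residue_cubes p)"
    using enum by (simp_all only: cubic_coset_enumeration_def)
  obtain i :: "int \<Rightarrow> 3" where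
    i_mult: "\<And>x y. \<lbrakk>x \<in> {1..<p}; y \<in> {1..<p}\<rbrakk> \<Longrightarrow> i (x * y mod p) = i x + i y"
    and C: "C 0 = {x \<in> {1..<p}. i x = 0}" "C 1 = {x \<in> {1..<p}. i x = 1}"
      "C 2 = {x \<in> {1..<p}. i x = 2}"
    by (rule G.index_3_hom[OF subgroup cube C0 bij, unfolded carrier mult]) blast+
  \<comment> \<open>Cosets are nonempty, which makes the index surjective.\<close>
  have nonempty: "C k \<noteq> {}" if "k \<in> {0, 1, 2}" for k
  proof -
    have "C k \<in> rcosets\<^bsub>residue_units p\<^esub> residue_cubes p"
      using bij that unfolding bij_betw_def by blast
    then show ?thesis
      by (rule subgroup.rcosets_non_empty[OF subgroup])
  qed
  note range = mod_mem_nonzero_residues[OF p]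
  show thesis
  proof
    \<comment> \<open>The map \<open>i\<close> is controlled only on the representatives
      \<open>{1..<p}\<close>; reducing first extends it to all integers.\<close>
    show "cubic_residue_index p (\<lambda>x. i (x mod p))"
    proof
      show "i (x * y mod p) = i (x mod p) + i (y mod p)" if "\<not> p dvd x" "\<not> p dvd y" for x y
        using i_mult[OF range[OF that(1)] range[OF that(2)]] by (simp add: mod_mult_eq)
    next
      fix k :: 3
      have "k = 0 \<or> k = 1 \<or> k = 2"
        using exhaust_3[of k] by auto
      then obtain x where "x \<in> {1..<p}" "i x = k"
        using nonempty[of 0] nonempty[of 1] nonempty[of 2] C by auto
      then show "\<exists>x. \<not> p dvd x \<and> i (x mod p) = k"
        using zdvd_not_zless by (intro exI[of _ x]) auto
    qed (use \<open>prime p\<close> in simp_all)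
  qed (use C in auto)
qed

lemma gauss_period_invariants:
  assumes "prime p" "cubic_coset_enumeration p C"
  obtains L M :: int where
    "[L = 1] (mod 3)" "4 * p = L\<^sup>2 + 27 * M\<^sup>2"
    "gauss_period p C 0 + gauss_period p C 1 + gauss_period p C 2 = -1"
    "gauss_period p C 0 * gauss_period p C 1 + gauss_period p C 1 * gauss_period p C 2 +
       gauss_period p C 2 * gauss_period p C 0 = - ((of_int p - 1) / 3)"
    "27 * (gauss_period p C 0 * gauss_period p C 1 * gauss_period p C 2) =
       of_int p * (of_int L + 3) - 1"
proof -
  obtain ind where ind: "cubic_residue_index p ind"
    and C: "C 0 = {x \<in> {1..<p}. ind x = 0}" "C 1 = {x \<in> {1..<p}. ind x = 1}"
      "C 2 = {x \<in> {1..<p}. ind x = 2}"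
    using cubic_residue_index_of_enumeration[OF assms] by blast
  interpret cubic_residue_index p ind by fact
  have "gauss_period p C 0 = period 0" "gauss_period p C 1 = period 1"
    "gauss_period p C 2 = period 2"
    unfolding gauss_period_def period_def cls_def root_unity_def C by (rule refl)+
  then show thesis
    using that sum_period period_invariants by metis
qed

section \<open>Cubics with prescribed roots, and the zeros of \<open>rho\<close>\<close>

lemma poly_of_roots_3:
  fixes a b c :: "'a :: comm_ring_1"
  shows "[:-a, 1:] * [:-b, 1:] * [:-c, 1:] = [:- (a * b * c), a * b + b * c + c * a, - (a + b + c), 1:]"
  by (simp add: algebra_simps)

lemma proots_cubic:
  fixes a b c :: "'a :: idom"
  shows "proots [:- (a * b * c), a * b + b * c + c * a, - (a + b + c), 1:] = {#a, b, c#}"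
proof -
  have "proots ([:-a, 1:] * [:-b, 1:] * [:-c, 1:]) = {#a, b, c#}"
    by (simp add: proots_mult del: mult_pCons_left mult_pCons_right)
  then show ?thesis
    unfolding poly_of_roots_3 .
qed

theorem theorem18:
  fixes h p :: int and s :: real and C :: "nat \<Rightarrow> int set"
  assumes "\<not> 3 dvd h"
    and "p = h\<^sup>2 + 3 * h + 9"
    and "prime p"
    and "s \<noteq> 0"
    and "cubic_coset_enumeration p C"
  shows "([h = 1] (mod 3) \<longrightarrow>
           proots (rho h s) = {# \<gamma>\<^sub>1 h s (gauss_period p C k). k \<in># mset_set {0, 1, 2} #}) \<and>
         ([h = 2] (mod 3) \<longrightarrow>
           proots (rho h s) = {# \<gamma>\<^sub>2 h s (gauss_period p C k). k \<in># mset_set {0, 1, 2} #}) \<and>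
         ([h = 1] (mod 3) \<longrightarrow>
           (\<forall>x. poly (rho h s) x = of_real s ^ 3 * poly (G\<^sub>1 h) (\<theta>\<^sub>1 h s x))) \<and>
         ([h = 2] (mod 3) \<longrightarrow>
           (\<forall>x. poly (rho h s) x = - (of_real s ^ 3) * poly (G\<^sub>2 h) (\<theta>\<^sub>2 h s x)))"
proof -
  define H P S where "H = (of_int h :: complex)" and "P = (of_int p :: complex)"
    and "S = (of_real s :: complex)"
  have P: "P = H\<^sup>2 + 3 * H + 9"
    by (simp add: assms(2) H_def P_def)
  have S: "S \<noteq> 0"
    using assms(4) by (simp add: S_def)
  define x y z where "x = gauss_period p C 0" and "y = gauss_period p C 1"
    and "z = gauss_period p C 2"
  obtain L M :: int where L: "[L = 1] (mod 3)" and LM: "4 * p = L\<^sup>2 + 27 * M\<^sup>2"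
    and e: "x + y + z = -1" "x * y + y * z + z * x = - ((P - 1) / 3)"
      "27 * (x * y * z) = P * (of_int L + 3) - 1"
    using gauss_period_invariants[OF assms(3,5)] unfolding x_def y_def z_def P_def by metis
  \<comment> \<open>This is the representation with \<open>M = 1\<close>, so uniqueness determines
    \<open>L\<close> up to sign.\<close>
  have "4 * p = (2 * h + 3)\<^sup>2 + 27"
    by (simp add: assms(2) algebra_simps power2_eq_square)
  then have L_cases: "L = 2 * h + 3 \<or> L = - (2 * h + 3)"
    using norm_form_unique[OF assms(3) LM] by blast
  have rho: "rho h s = [:S ^ 3, - (H + 3) * S\<^sup>2, H * S, 1:]"
    by (simp add: rho_def H_def S_def)
  have roots: "proots (rho h s) = {#a, b, c#}"
    if "S ^ 3 = - (a * b * c)" "- (H + 3) * S\<^sup>2 = a * b + b * c + c * a" "H * S = - (a + b + c)"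
    for a b c
    unfolding rho that by (rule proots_cubic)
  have e1_z: "z = -1 - x - y"
    using e(1) by (simp add: algebra_simps)
  have case_1: "proots (rho h s) = {#\<gamma>\<^sub>1 h s x, \<gamma>\<^sub>1 h s y, \<gamma>\<^sub>1 h s z#}" if "[h = 1] (mod 3)"
  proof (rule roots)
    \<comment> \<open>Here \<open>2 * h + 3\<close> is 2 modulo 3, whereas \<open>L\<close> is
      1.\<close>
    have "L \<noteq> 2 * h + 3"
      using that L unfolding cong_def by presburger
    then have L_eq: "of_int L = - (2 * H + 3)"
      using L_cases by (simp add: H_def)
    have "27 * (x * y * z) = - (2 * H * P + 1)"
      unfolding e(3) L_eq by (simp add: algebra_simps)
    then have e3: "x * y * z = - (2 * H * P + 1) / 27"
      by (simp add: eq_divide_eq mult.commute)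
    \<comment> \<open>The shifted periods \<open>x - t\<close>, \<open>y - t\<close>,
      \<open>z - t\<close> turn out to be the zeros of Shanks's simplest cubic
      \<open>w^3 + H w^2 - (H + 3) w + 1\<close>; scaling them by \<open>S\<close> gives the zeros
      of \<open>rho\<close>. The three coefficients are compared in turn.\<close>
    define t where "t = (H - 1) / 3"
    have g: "\<gamma>\<^sub>1 h s w = S * (w - t)" for w
      by (simp add: \<gamma>\<^sub>1_def t_def H_def S_def field_simps)
    have H: "H = 3 * t + 1"
      by (simp add: t_def field_simps)
    have "(x - t) * (y - t) * (z - t) = x * y * z - t * (x * y + y * z + z * x) + t\<^sup>2 * (x + y + z) - t ^ 3"
      by (simp add: algebra_simps power2_eq_square power3_eq_cube)
    also have "\<dots> = -1"
      unfolding e e3 P H by (simp add: field_simps power2_eq_square power3_eq_cube)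
    finally have "S ^ 3 * ((x - t) * (y - t) * (z - t)) = S ^ 3 * (-1)"
      by simp
    then show "S ^ 3 = - (\<gamma>\<^sub>1 h s x * \<gamma>\<^sub>1 h s y * \<gamma>\<^sub>1 h s z)"
      unfolding g by (simp add: algebra_simps power3_eq_cube)
    have "(x - t) * (y - t) + (y - t) * (z - t) + (z - t) * (x - t) =
        (x * y + y * z + z * x) - 2 * t * (x + y + z) + 3 * t\<^sup>2"
      by (simp add: algebra_simps power2_eq_square)
    also have "\<dots> = - (H + 3)"
      unfolding e P H by (simp add: field_simps power2_eq_square)
    finally have "S\<^sup>2 * (- (H + 3)) = S\<^sup>2 * ((x - t) * (y - t) + (y - t) * (z - t) + (z - t) * (x - t))"
      by simp
    then show "- (H + 3) * S\<^sup>2 = \<gamma>\<^sub>1 h s x * \<gamma>\<^sub>1 h s y + \<gamma>\<^sub>1 h s y * \<gamma>\<^sub>1 h s z + \<gamma>\<^sub>1 h s z * \<gamma>\<^sub>1 h s x"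
      unfolding g by (simp add: algebra_simps power2_eq_square)
    show "H * S = - (\<gamma>\<^sub>1 h s x + \<gamma>\<^sub>1 h s y + \<gamma>\<^sub>1 h s z)"
      unfolding g H e1_z by (simp add: algebra_simps)
  qed
  have case_2: "proots (rho h s) = {#\<gamma>\<^sub>2 h s x, \<gamma>\<^sub>2 h s y, \<gamma>\<^sub>2 h s z#}" if "[h = 2] (mod 3)"
  proof (rule roots)
    \<comment> \<open>Now \<open>2 * h + 3\<close> is 1 modulo 3, so the other sign is
      excluded.\<close>
    have "h mod 3 = 2" "L mod 3 = 1"
      using that L by (simp_all add: cong_def)
    then have "L \<noteq> - (2 * h + 3)"
      by presburger
    then have L_eq: "of_int L = 2 * H + 3"
      using L_cases by (simp add: H_def)
    have "27 * (x * y * z) = (2 * H + 6) * P - 1"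
      unfolding e(3) L_eq by (simp add: algebra_simps)
    then have e3: "x * y * z = ((2 * H + 6) * P - 1) / 27"
      by (simp add: eq_divide_eq mult.commute)
    \<comment> \<open>The same simplest cubic arises, this time with zeros \<open>- (x + t)\<close>,
      \<open>- (y + t)\<close>, \<open>- (z + t)\<close>.\<close>
    define t where "t = (H + 1) / 3"
    have g: "\<gamma>\<^sub>2 h s w = - S * (w + t)" for w
      by (simp add: \<gamma>\<^sub>2_def t_def H_def S_def field_simps)
    have H: "H = 3 * t - 1"
      by (simp add: t_def field_simps)
    have "(x + t) * (y + t) * (z + t) = x * y * z + t * (x * y + y * z + z * x) + t\<^sup>2 * (x + y + z) + t ^ 3"
      by (simp add: algebra_simps power2_eq_square power3_eq_cube)
    also have "\<dots> = 1"
      unfolding e e3 P H by (simp add: field_simps power2_eq_square power3_eq_cube)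
    finally have "S ^ 3 * ((x + t) * (y + t) * (z + t)) = S ^ 3 * 1"
      by simp
    then show "S ^ 3 = - (\<gamma>\<^sub>2 h s x * \<gamma>\<^sub>2 h s y * \<gamma>\<^sub>2 h s z)"
      unfolding g by (simp add: algebra_simps power3_eq_cube)
    have "(x + t) * (y + t) + (y + t) * (z + t) + (z + t) * (x + t) =
        (x * y + y * z + z * x) + 2 * t * (x + y + z) + 3 * t\<^sup>2"
      by (simp add: algebra_simps power2_eq_square)
    also have "\<dots> = - (H + 3)"
      unfolding e P H by (simp add: field_simps power2_eq_square)
    finally have "S\<^sup>2 * (- (H + 3)) = S\<^sup>2 * ((x + t) * (y + t) + (y + t) * (z + t) + (z + t) * (x + t))"
      by simp
    then show "- (H + 3) * S\<^sup>2 = \<gamma>\<^sub>2 h s x * \<gamma>\<^sub>2 h s y + \<gamma>\<^sub>2 h s y * \<gamma>\<^sub>2 h s z + \<gamma>\<^sub>2 h s z * \<gamma>\<^sub>2 h s x"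
      unfolding g by (simp add: algebra_simps power2_eq_square)
    show "H * S = - (\<gamma>\<^sub>2 h s x + \<gamma>\<^sub>2 h s y + \<gamma>\<^sub>2 h s z)"
      unfolding g H e1_z by (simp add: algebra_simps)
  qed
  have P_h: "of_int (h\<^sup>2 + 3 * h + 9) = P"
    by (simp add: P_def assms(2))
  have G1: "poly (rho h s) v = of_real s ^ 3 * poly (G\<^sub>1 h) (\<theta>\<^sub>1 h s v)" for v
  proof -
    \<comment> \<open>With \<open>v = S * w\<close> both sides are the cube of \<open>S\<close>
      times a polynomial in \<open>w\<close> and \<open>H\<close>, once \<open>P\<close> is replaced
      by its value.\<close>
    obtain w where v: "v = S * w"
      using S by (metis nonzero_mult_div_cancel_left times_divide_eq_right)
    have theta: "\<theta>\<^sub>1 h s v = w + (H - 1) / 3"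
      using S by (simp add: \<theta>\<^sub>1_def v S_def H_def)
    show ?thesis
      unfolding theta rho G\<^sub>1_def Let_def P_h P
      unfolding v
      by (simp add: field_simps power2_eq_square power3_eq_cube flip: S_def H_def)
  qed
  have G2: "poly (rho h s) v = - (of_real s ^ 3) * poly (G\<^sub>2 h) (\<theta>\<^sub>2 h s v)" for v
  proof -
    obtain w where v: "v = S * w"
      using S by (metis nonzero_mult_div_cancel_left times_divide_eq_right)
    have theta: "\<theta>\<^sub>2 h s v = - w - (H + 1) / 3"
      using S by (simp add: \<theta>\<^sub>2_def v S_def H_def)
    show ?thesis
      unfolding theta rho G\<^sub>2_def Let_def P_h P
      unfolding v
      by (simp add: field_simps power2_eq_square power3_eq_cube flip: S_def H_def)
  qed
  show ?thesis
    using case_1 case_2 G1 G2 by (simp add: x_def y_def z_def)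
qed

end
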